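(* A network has the global lca-property if and only if it is a holju graph.
   Context: A DAG is a finite directed graph without loops and directed cycles; $u\preceq_G v$ means there is a directed path from $v$ to $u$ (including $u=v$). A leaf is a $\preceq_G$-minimal vertex. A network is a DAG with exactly one $\preceq_G$-maximal vertex. For non-empty $A\subseteq V(G)$, $\mathrm{LCA}_G(A)$ is the set of $\preceq_G$-minimal vertices $v$ with $a\preceq_G v$ for all $a\in A$; $G$ has the global lca-property if $|\mathrm{LCA}_G(A)|=1$ for all non-empty $A\subseteq V(G)$. For a DAG $G$, $W\subseteq V(G)$ and $v\in V(G)$, put $\mathcal{L}_G(W\mid v)=\bigcup_{w\in W}\mathrm{LCA}_G(\{w,v\})$. The class of holju graphs is defined recursively: the single-vertex graph $K_1$ is holju; if $G$ is holju, then so is any graph obtained from $G$ by adding a new vertex $x\notin V(G)$ together with edges $(w,x)$ for all $w\in W$, where $W\subseteq V(G)$ is non-empty and, for every $v\in V(G)$, the set $\mathcal{L}_G(W\mid v)$ contains a unique $\preceq_G$-minimal vertex ($|W|=1$ allowed). *)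

theory Defs
  imports "Graph_Theory.Pair_Digraph"
begin

(* Finite directed graphs without loops and without parallel edges are the library's
   pair_digraph; an edge (u,v) points from u to v. *)

locale dag = pair_digraph +
  assumes no_cycle: "\<nexists>p. cycle p"

(* Ancestors are the larger elements: u is below v if u can be reached from v.  The library's
   reachability only relates vertices of G and is reflexive on them. *)
abbreviation below :: "'a pair_pre_digraph \<Rightarrow> 'a \<Rightarrow> 'a \<Rightarrow> bool" (\<open>_ \<preceq>\<index> _\<close> [100,100] 40) where
  "below G u v \<equiv> v \<rightarrow>\<^sup>*\<^bsub>with_proj G\<^esub> u"

definition minimal_in :: "'a pair_pre_digraph \<Rightarrow> 'a set \<Rightarrow> 'a \<Rightarrow> bool" where
  "minimal_in G S u \<longleftrightarrow> u \<in> S \<and> (\<forall>s\<in>S. s \<preceq>\<^bsub>G\<^esub> u \<longrightarrow> s = u)"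

definition maximal_in :: "'a pair_pre_digraph \<Rightarrow> 'a set \<Rightarrow> 'a \<Rightarrow> bool" where
  "maximal_in G S u \<longleftrightarrow> u \<in> S \<and> (\<forall>s\<in>S. u \<preceq>\<^bsub>G\<^esub> s \<longrightarrow> s = u)"

locale network = dag +
  assumes unique_maximal: "\<exists>!r. maximal_in G (pverts G) r"

definition LCA :: "'a pair_pre_digraph \<Rightarrow> 'a set \<Rightarrow> 'a set" where
  "LCA G A = {u. minimal_in G {v \<in> pverts G. \<forall>a\<in>A. a \<preceq>\<^bsub>G\<^esub> v} u}"

definition global_lca_property :: "'a pair_pre_digraph \<Rightarrow> bool" where
  "global_lca_property G \<longleftrightarrow> (\<forall>A. A \<noteq> {} \<and> A \<subseteq> pverts G \<longrightarrow> card (LCA G A) = 1)"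

definition LCA_union :: "'a pair_pre_digraph \<Rightarrow> 'a set \<Rightarrow> 'a \<Rightarrow> 'a set" where
  "LCA_union G W v = (\<Union>w\<in>W. LCA G {w, v})"

(* The class is closed under relabelling of vertices: K_1 is any graph with exactly one vertex
   and no edges, and the added vertex x may be any element outside G. *)
inductive holju :: "'a pair_pre_digraph \<Rightarrow> bool" where
  single: "holju \<lparr>pverts = {x}, parcs = {}\<rparr>"
| extend: "\<lbrakk>holju G; x \<notin> pverts G; W \<subseteq> pverts G; W \<noteq> {};
            \<And>v. v \<in> pverts G \<Longrightarrow> \<exists>!u. minimal_in G (LCA_union G W v) u\<rbrakk>
    \<Longrightarrow> holju \<lparr>pverts = insert x (pverts G), parcs = parcs G \<union> {(w, x) |w. w \<in> W}\<rparr>"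

end

(* In an acyclic digraph reachability is a partial order, so the global lca-property says that
   every two vertices have a least upper bound.  Attaching a leaf x below W leaves the order on
   the old vertices unchanged, and the common upper bounds of x and v are those of w and v for
   w in W.  Hence x and v have a least upper bound exactly if the lcas of the pairs {w, v} have
   a least element, which is the condition in the definition of holju graphs.  Both directions
   follow by attaching or removing one leaf at a time. *)
theory Submission
  imports Defs
begin

section \<open>Finite acyclic digraphs and least upper bounds\<close>

locale finite_acyclic = pair_wf_digraph +
  assumes finite_verts: "finite (pverts G)"
    and acyclic_arcs: "acyclic (parcs G)"

text \<open>A pair \<open>(v, v)\<close> in the transitive closure yields a non-empty closed walk,
  and such a walk contains a cycle.\<close>

lemma (in dag) finite_acyclic: "finite_acyclic G"
proof
  show "finite (pverts G)"
    by (rule pair_finite_verts)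
  show "acyclic (parcs G)"
  proof (rule acyclicI, intro allI notI)
    fix v assume "(v, v) \<in> (parcs G)\<^sup>+"
    then obtain p where "awalk v p v" "p \<noteq> []"
      by (auto simp: reachable1_awalk)
    then have "closed_w p"
      by (auto simp: closed_w_def)
    then show False
      using closed_w_imp_cycle no_cycle by blast
  qed
qed

definition is_lub :: "'a pair_pre_digraph \<Rightarrow> 'a set \<Rightarrow> 'a \<Rightarrow> bool" where
  "is_lub G A z \<longleftrightarrow> z \<in> pverts G \<and> (\<forall>a\<in>A. a \<preceq>\<^bsub>G\<^esub> z) \<and>
    (\<forall>y\<in>pverts G. (\<forall>a\<in>A. a \<preceq>\<^bsub>G\<^esub> y) \<longrightarrow> z \<preceq>\<^bsub>G\<^esub> y)"

text \<open>Restricting to pairs lets the property be checked leaf by leaf; larger sets are handled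
  by \<open>has_joins_finite_lub\<close>.\<close>

definition has_joins :: "'a pair_pre_digraph \<Rightarrow> bool" where
  "has_joins G \<longleftrightarrow> (\<forall>u\<in>pverts G. \<forall>v\<in>pverts G. \<exists>z. is_lub G {u, v} z)"

lemma has_joinsE:
  assumes "has_joins G" "u \<in> pverts G" "v \<in> pverts G"
  obtains z where "is_lub G {u, v} z"
  using assms unfolding has_joins_def by metis

text \<open>A name for the graph built in \<open>holju.extend\<close>. Here \<open>W\<close> may be
  empty, so that isolated vertices also count as leaves in \<open>remove_leaf\<close>.\<close>

definition add_leaf :: "'a pair_pre_digraph \<Rightarrow> 'a \<Rightarrow> 'a set \<Rightarrow> 'a pair_pre_digraph" where
  "add_leaf G x W =
    \<lparr>pverts = insert x (pverts G), parcs = parcs G \<union> {(w, x) |w. w \<in> W}\<rparr>"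

lemma (in pair_wf_digraph) below_iff:
  "u \<preceq>\<^bsub>G\<^esub> v \<longleftrightarrow> v \<in> pverts G \<and> (v, u) \<in> (parcs G)\<^sup>*"
proof
  assume "u \<preceq>\<^bsub>G\<^esub> v"
  then show "v \<in> pverts G \<and> (v, u) \<in> (parcs G)\<^sup>*"
    using reachable_in_verts(1) reachable_rtranclI by auto
next
  assume "v \<in> pverts G \<and> (v, u) \<in> (parcs G)\<^sup>*"
  then show "u \<preceq>\<^bsub>G\<^esub> v"
    using reachable1_reachable by (auto simp: rtrancl_eq_or_trancl)
qed

section \<open>The reachability order and its joins\<close>

context finite_acyclic
begin

lemma below_in_verts: "u \<preceq>\<^bsub>G\<^esub> v \<Longrightarrow> u \<in> pverts G \<and> v \<in> pverts G"
  using reachable_in_verts by blast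

lemma below_trans: "u \<preceq>\<^bsub>G\<^esub> v \<Longrightarrow> v \<preceq>\<^bsub>G\<^esub> w \<Longrightarrow> u \<preceq>\<^bsub>G\<^esub> w"
  using reachable_trans by blast

lemma below_antisym: "u \<preceq>\<^bsub>G\<^esub> v \<Longrightarrow> v \<preceq>\<^bsub>G\<^esub> u \<Longrightarrow> u = v"
  using acyclic_impl_antisym_rtrancl[OF acyclic_arcs]
  by (auto simp: below_iff dest: antisymD)

text \<open>The elements of \<open>S\<close> below \<open>s\<close> form a finite non-empty set. A
  minimal element of it is minimal in all of \<open>S\<close>, since anything below it is again
  below \<open>s\<close>.\<close>

lemma ex_minimal_below:
  assumes "S \<subseteq> pverts G" "s \<in> S"
  shows "\<exists>u. minimal_in G S u \<and> u \<preceq>\<^bsub>G\<^esub> s"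
proof -
  define T where "T = {t \<in> S. t \<preceq>\<^bsub>G\<^esub> s}"
  define R where "R y z \<longleftrightarrow> y \<preceq>\<^bsub>G\<^esub> z \<and> y \<noteq> z" for y z
  have "finite S"
    using assms(1) finite_verts by (rule finite_subset)
  then have "finite T"
    by (simp add: T_def)
  moreover have "T \<noteq> {}"
    using assms by (auto simp: T_def)
  moreover have "asymp_on T R" "transp_on T R"
    unfolding R_def using below_antisym below_trans by (blast intro: asymp_onI transp_onI)+
  ultimately obtain u where "u \<in> T" "\<forall>t\<in>T. t \<noteq> u \<longrightarrow> \<not> R t u"
    using Finite_Set.bex_min_element[of T R] by blast
  then show ?thesis
    unfolding minimal_in_def T_def R_def using below_trans by blast
qed

text \<open>By finiteness every element of \<open>S\<close> lies above a minimal one, so a sole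
  minimal element is least. Antisymmetry gives the converse.\<close>

lemma unique_minimal_iff_least:
  assumes "S \<subseteq> pverts G"
  shows "(\<exists>!u. minimal_in G S u) \<longleftrightarrow> (\<exists>u\<in>S. \<forall>s\<in>S. u \<preceq>\<^bsub>G\<^esub> s)"
proof
  assume "\<exists>!u. minimal_in G S u"
  then obtain u where u: "minimal_in G S u" "\<And>v. minimal_in G S v \<Longrightarrow> v = u"
    by blast
  then have "\<forall>s\<in>S. u \<preceq>\<^bsub>G\<^esub> s"
    using ex_minimal_below[OF assms] by blast
  with u(1) show "\<exists>u\<in>S. \<forall>s\<in>S. u \<preceq>\<^bsub>G\<^esub> s"
    by (auto simp: minimal_in_def)
next
  assume "\<exists>u\<in>S. \<forall>s\<in>S. u \<preceq>\<^bsub>G\<^esub> s"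
  then show "\<exists>!u. minimal_in G S u"
    unfolding minimal_in_def using below_antisym by metis
qed

text \<open>\<open>LCA G A\<close> consists of the minimal elements of the set of common upper
  bounds, to which \<open>unique_minimal_iff_least\<close> applies.\<close>

lemma card_LCA_eq_1_iff: "card (LCA G A) = 1 \<longleftrightarrow> (\<exists>z. is_lub G A z)"
proof -
  let ?U = "{v \<in> pverts G. \<forall>a\<in>A. a \<preceq>\<^bsub>G\<^esub> v}"
  have "card {u. P u} = 1 \<longleftrightarrow> (\<exists>!u. P u)" for P :: "'a \<Rightarrow> bool"
    unfolding One_nat_def card_1_singleton_iff set_eq_iff mem_Collect_eq singleton_iff by metis
  then have "card (LCA G A) = 1 \<longleftrightarrow> (\<exists>!u. minimal_in G ?U u)"
    unfolding LCA_def .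
  also have "\<dots> \<longleftrightarrow> (\<exists>u\<in>?U. \<forall>s\<in>?U. u \<preceq>\<^bsub>G\<^esub> s)"
    by (rule unique_minimal_iff_least) blast
  also have "\<dots> \<longleftrightarrow> (\<exists>z. is_lub G A z)"
    by (auto simp: is_lub_def)
  finally show ?thesis .
qed

lemma LCA_eq_lub:
  assumes "is_lub G A z"
  shows "LCA G A = {z}"
proof -
  have z: "z \<in> {v \<in> pverts G. \<forall>a\<in>A. a \<preceq>\<^bsub>G\<^esub> v}"
    using assms by (simp add: is_lub_def)
  have least: "z \<preceq>\<^bsub>G\<^esub> y" if "y \<in> {v \<in> pverts G. \<forall>a\<in>A. a \<preceq>\<^bsub>G\<^esub> v}" for y
    using that assms by (simp add: is_lub_def)
  have "u \<in> LCA G A \<longleftrightarrow> u = z" for u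
  proof
    assume "u \<in> LCA G A"
    then show "u = z"
      using z least[of u] by (auto simp: LCA_def minimal_in_def)
  next
    assume "u = z"
    then show "u \<in> LCA G A"
      using z least by (auto simp: LCA_def minimal_in_def intro: below_antisym)
  qed
  then show ?thesis
    by blast
qed

text \<open>Induction on \<open>A\<close>: the join of \<open>a\<close> with the join of the
  remaining elements is the join of all.\<close>

lemma has_joins_finite_lub:
  assumes "has_joins G" "finite A" "A \<noteq> {}" "A \<subseteq> pverts G"
  shows "\<exists>z. is_lub G A z"
  using assms(2-4)
proof (induction A rule: finite_ne_induct)
  case (singleton a)
  then show ?case
    using assms(1) unfolding has_joins_def by fastforce
next
  case (insert a A)
  then obtain y where y: "is_lub G A y"
    by auto
  then have "y \<in> pverts G"
    by (simp add: is_lub_def)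
  then obtain z where "is_lub G {a, y} z"
    using has_joinsE[OF assms(1), of a y] insert.prems by auto
  with y have "is_lub G (insert a A) z"
    unfolding is_lub_def using below_trans by blast
  then show ?case ..
qed

lemma global_lca_property_iff_has_joins: "global_lca_property G \<longleftrightarrow> has_joins G"
proof
  assume "global_lca_property G"
  then show "has_joins G"
    unfolding has_joins_def global_lca_property_def card_LCA_eq_1_iff by simp
next
  assume "has_joins G"
  then show "global_lca_property G"
    unfolding global_lca_property_def card_LCA_eq_1_iff
    using has_joins_finite_lub finite_subset[OF _ finite_verts] by simp
qed

section \<open>Attaching a leaf\<close>

context
  fixes x :: 'a and W :: "'a set"
  assumes x: "x \<notin> pverts G" and W: "W \<subseteq> pverts G"
begin

text \<open>No arc leaves \<open>x\<close>, so a path can use a new arc only as its last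
  step.\<close>

lemma trancl_add_leaf:
  "(u, v) \<in> (parcs (add_leaf G x W))\<^sup>+ \<longleftrightarrow>
    (u, v) \<in> (parcs G)\<^sup>+ \<or> v = x \<and> (\<exists>w\<in>W. (u, w) \<in> (parcs G)\<^sup>*)" (is "?L \<longleftrightarrow> ?R")
proof
  assume ?L
  then show ?R
  proof induction
    case (base v)
    then show ?case
      by (auto simp: add_leaf_def)
  next
    case (step v t)
    have "(v, t) \<in> parcs G \<or> v \<in> W \<and> t = x"
      using step.hyps(2) by (auto simp: add_leaf_def)
    \<comment> \<open>This excludes the second alternative of the induction hypothesis: the path up
      to \<open>v\<close> lies in \<open>G\<close>.\<close>
    moreover have "v \<noteq> x"
      using calculation x W in_arcsD1 by blast
    ultimately show ?case
      using step.IH by (auto intro: trancl_into_trancl trancl_into_rtrancl)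
  qed
next
  have sub: "parcs G \<subseteq> parcs (add_leaf G x W)"
    by (auto simp: add_leaf_def)
  have leaf: "(w, x) \<in> parcs (add_leaf G x W)" if "w \<in> W" for w
    using that by (auto simp: add_leaf_def)
  assume ?R
  then show ?L
  proof (elim disjE conjE bexE)
    assume "(u, v) \<in> (parcs G)\<^sup>+"
    then show ?L
      using sub by (rule trancl_mono)
  next
    fix w assume "v = x" "w \<in> W" "(u, w) \<in> (parcs G)\<^sup>*"
    then show ?L
      using rtrancl_mono[OF sub] leaf by (blast intro: rtrancl_into_trancl1)
  qed
qed

lemma finite_acyclic_add_leaf: "finite_acyclic (add_leaf G x W)"
proof
  show "finite (pverts (add_leaf G x W))"
    using finite_verts by (simp add: add_leaf_def)
  show "acyclic (parcs (add_leaf G x W))"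
  proof (rule acyclicI, intro allI notI)
    fix v assume "(v, v) \<in> (parcs (add_leaf G x W))\<^sup>+"
    then consider "(v, v) \<in> (parcs G)\<^sup>+" | w where "v = x" "w \<in> W" "(x, w) \<in> (parcs G)\<^sup>*"
      unfolding trancl_add_leaf by blast
    then show False
    proof cases
      case 1
      then show False
        using acyclic_arcs by (simp add: acyclic_def)
    next
      case 2
      \<comment> \<open>The path is empty, so that \<open>x\<close> is in \<open>W\<close>, or its
        first arc starts at \<open>x\<close>; both put \<open>x\<close> into
        \<open>pverts G\<close>.\<close>
      then show False
        using x W in_arcsD1 by (auto elim: converse_rtranclE)
    qed
  qed
qed (use W in \<open>auto simp: add_leaf_def dest: in_arcsD1 in_arcsD2\<close>)

text \<open>By \<open>trancl_add_leaf\<close>, a path ending in an old vertex uses no new arc. For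
  \<open>v = x\<close> both sides are false.\<close>

lemma below_add_leaf_old:
  assumes "u \<in> pverts G"
  shows "u \<preceq>\<^bsub>add_leaf G x W\<^esub> v \<longleftrightarrow> u \<preceq>\<^bsub>G\<^esub> v"
proof -
  interpret H: finite_acyclic "add_leaf G x W"
    by (rule finite_acyclic_add_leaf)
  have "x \<noteq> u" "pverts (add_leaf G x W) = insert x (pverts G)"
    using assms x by (auto simp: add_leaf_def)
  moreover have "(x, u) \<notin> (parcs G)\<^sup>+"
    using x in_arcsD1 by (auto dest: tranclD)
  ultimately show ?thesis
    unfolding H.below_iff below_iff rtrancl_eq_or_trancl trancl_add_leaf by auto
qed

lemma below_add_leaf_new:
  "x \<preceq>\<^bsub>add_leaf G x W\<^esub> v \<longleftrightarrow> v = x \<or> (\<exists>w\<in>W. w \<preceq>\<^bsub>G\<^esub> v)"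
proof -
  interpret H: finite_acyclic "add_leaf G x W"
    by (rule finite_acyclic_add_leaf)
  have "pverts (add_leaf G x W) = insert x (pverts G)"
    by (simp add: add_leaf_def)
  moreover have "(x, w) \<notin> (parcs G)\<^sup>*" if "w \<in> W" for w
    using that x W in_arcsD1 by (auto elim: converse_rtranclE)
  moreover have "(v, x) \<notin> (parcs G)\<^sup>+"
    using x in_arcsD2 by (auto dest: tranclD2)
  ultimately show ?thesis
    unfolding H.below_iff below_iff rtrancl_eq_or_trancl[of v x] trancl_add_leaf by auto
qed

text \<open>Neither \<open>u\<close> nor \<open>v\<close> is below \<open>x\<close>, so both graphs
  give the same common upper bounds, ordered in the same way.\<close>

lemma is_lub_add_leaf_old:
  assumes "u \<in> pverts G" "v \<in> pverts G"
  shows "is_lub (add_leaf G x W) {u, v} z \<longleftrightarrow> is_lub G {u, v} z"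
proof -
  let ?H = "add_leaf G x W"
  have verts: "pverts ?H = insert x (pverts G)"
    by (simp add: add_leaf_def)
  have ub: "(\<forall>a\<in>{u, v}. a \<preceq>\<^bsub>?H\<^esub> y) \<longleftrightarrow> (\<forall>a\<in>{u, v}. a \<preceq>\<^bsub>G\<^esub> y)" for y
    using assms by (simp add: below_add_leaf_old)
  have not_below: "\<not> u \<preceq>\<^bsub>G\<^esub> x"
    using x below_in_verts by blast
  then have not_ub: "\<not> (\<forall>a\<in>{u, v}. a \<preceq>\<^bsub>G\<^esub> x)"
    by simp
  have lub_verts: "z \<in> pverts G" if "is_lub ?H {u, v} z"
  proof -
    have "z = x \<or> z \<in> pverts G" "\<forall>a\<in>{u, v}. a \<preceq>\<^bsub>G\<^esub> z"
      using that unfolding is_lub_def ub verts by simp_all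
    with not_ub show ?thesis
      by metis
  qed
  show ?thesis
  proof (cases "z \<in> pverts G")
    case True
    show ?thesis
      unfolding is_lub_def ub verts below_add_leaf_old[OF True] using True not_below by simp
  next
    case False
    then show ?thesis
      using lub_verts by (auto simp: is_lub_def)
  qed
qed

lemma is_lub_add_leaf_new:
  assumes "v \<in> pverts G" "has_joins G"
  shows "(\<exists>z. is_lub (add_leaf G x W) {x, v} z) \<longleftrightarrow> (\<exists>!u. minimal_in G (LCA_union G W v) u)"
proof -
  have verts: "pverts (add_leaf G x W) = insert x (pverts G)"
    by (simp add: add_leaf_def)
  obtain j where j: "\<And>w. w \<in> W \<Longrightarrow> is_lub G {w, v} (j w)"
  proof -
    have "\<forall>w\<in>W. \<exists>z. is_lub G {w, v} z"
      using assms W by (auto simp: has_joins_def)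
    from bchoice[OF this] show ?thesis
      using that by metis
  qed
  have union: "LCA_union G W v = j ` W"
    using LCA_eq_lub[OF j] by (auto simp: LCA_union_def)
  have jV: "j ` W \<subseteq> pverts G"
    using j by (auto simp: is_lub_def)
  have ub: "(\<exists>w\<in>W. w \<preceq>\<^bsub>G\<^esub> y) \<and> v \<preceq>\<^bsub>G\<^esub> y \<longleftrightarrow> (\<exists>w\<in>W. j w \<preceq>\<^bsub>G\<^esub> y)" for y
  proof
    assume "(\<exists>w\<in>W. w \<preceq>\<^bsub>G\<^esub> y) \<and> v \<preceq>\<^bsub>G\<^esub> y"
    then show "\<exists>w\<in>W. j w \<preceq>\<^bsub>G\<^esub> y"
      using j below_in_verts unfolding is_lub_def by blast
  next
    assume "\<exists>w\<in>W. j w \<preceq>\<^bsub>G\<^esub> y"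
    then show "(\<exists>w\<in>W. w \<preceq>\<^bsub>G\<^esub> y) \<and> v \<preceq>\<^bsub>G\<^esub> y"
      using j below_trans unfolding is_lub_def by blast
  qed
  \<comment> \<open>The candidate \<open>y = x\<close> drops out because the old vertex
    \<open>v\<close> is not below \<open>x\<close>.\<close>
  have ub': "(\<forall>a\<in>{x, v}. a \<preceq>\<^bsub>add_leaf G x W\<^esub> y) \<longleftrightarrow> (\<exists>w\<in>W. j w \<preceq>\<^bsub>G\<^esub> y)" for y
    using assms(1) x below_in_verts[where u = v and v = x] ub[of y]
    by (auto simp: below_add_leaf_new below_add_leaf_old)
  have "is_lub (add_leaf G x W) {x, v} z \<longleftrightarrow> z \<in> j ` W \<and> (\<forall>s\<in>j ` W. z \<preceq>\<^bsub>G\<^esub> s)" for z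
  proof
    assume lub: "is_lub (add_leaf G x W) {x, v} z"
    then obtain w where w: "w \<in> W" "j w \<preceq>\<^bsub>G\<^esub> z"
      unfolding is_lub_def ub' by blast
    then have z: "z \<in> pverts G"
      using below_in_verts by blast
    have least: "\<forall>s\<in>j ` W. z \<preceq>\<^bsub>G\<^esub> s"
    proof
      fix s assume s: "s \<in> j ` W"
      then have "\<exists>w\<in>W. j w \<preceq>\<^bsub>G\<^esub> s" "s \<in> pverts (add_leaf G x W)"
        using jV by (auto simp: verts)
      then have "z \<preceq>\<^bsub>add_leaf G x W\<^esub> s"
        using lub unfolding is_lub_def ub' by simp
      then show "z \<preceq>\<^bsub>G\<^esub> s"
        using z below_add_leaf_old by blast
    qed
    \<comment> \<open>Now \<open>z\<close> is below \<open>j w\<close> as well as above it, hence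
      \<open>z = j w\<close>.\<close>
    with w below_antisym show "z \<in> j ` W \<and> (\<forall>s\<in>j ` W. z \<preceq>\<^bsub>G\<^esub> s)"
      by blast
  next
    assume z: "z \<in> j ` W \<and> (\<forall>s\<in>j ` W. z \<preceq>\<^bsub>G\<^esub> s)"
    then have zV: "z \<in> pverts G"
      using jV by blast
    then have "\<exists>w\<in>W. j w \<preceq>\<^bsub>G\<^esub> z"
      using z by auto
    moreover have "z \<preceq>\<^bsub>G\<^esub> y" if "\<exists>w\<in>W. j w \<preceq>\<^bsub>G\<^esub> y" for y
      using that z below_trans by blast
    ultimately show "is_lub (add_leaf G x W) {x, v} z"
      unfolding is_lub_def ub' verts below_add_leaf_old[OF zV] using zV by simp
  qed
  then show ?thesis
    unfolding union unique_minimal_iff_least[OF jV] by blast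
qed

text \<open>The pairs in the new graph are two old vertices, \<open>x\<close> with an old vertex,
  and \<open>x\<close> with itself; the last always has the join \<open>x\<close>.\<close>

lemma has_joins_add_leaf_iff:
  "has_joins (add_leaf G x W) \<longleftrightarrow>
    has_joins G \<and> (\<forall>v\<in>pverts G. \<exists>!u. minimal_in G (LCA_union G W v) u)"
proof -
  interpret H: finite_acyclic "add_leaf G x W"
    by (rule finite_acyclic_add_leaf)
  have verts: "pverts (add_leaf G x W) = insert x (pverts G)"
    by (simp add: add_leaf_def)
  have self: "is_lub (add_leaf G x W) {x, x} x"
    unfolding is_lub_def by (auto simp: verts)
  have old: "has_joins G \<longleftrightarrow>
      (\<forall>u\<in>pverts G. \<forall>v\<in>pverts G. \<exists>z. is_lub (add_leaf G x W) {u, v} z)"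
    unfolding has_joins_def using is_lub_add_leaf_old by simp
  have "has_joins (add_leaf G x W) \<longleftrightarrow>
      has_joins G \<and> (\<forall>v\<in>pverts G. \<exists>z. is_lub (add_leaf G x W) {x, v} z)"
    unfolding old has_joins_def[of "add_leaf G x W"] verts
    using self by (auto simp: insert_commute)
  \<comment> \<open>An equivalence under \<open>has_joins G\<close> suffices, since that conjunct
    occurs on both sides.\<close>
  moreover have "(\<forall>v\<in>pverts G. \<exists>z. is_lub (add_leaf G x W) {x, v} z) \<longleftrightarrow>
      (\<forall>v\<in>pverts G. \<exists>!u. minimal_in G (LCA_union G W v) u)" if "has_joins G"
    by (rule ball_cong[OF refl]) (rule is_lub_add_leaf_new[OF _ that])
  ultimately show ?thesis
    by blast
qed

end

section \<open>Removing a leaf\<close>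

text \<open>A minimal vertex exists by finiteness and has no outgoing arcs, so deleting it removes
  only the arcs from its in-neighbours \<open>W\<close>.\<close>

lemma remove_leaf:
  assumes "pverts G \<noteq> {}"
  obtains H x W where "finite_acyclic H" "x \<notin> pverts H" "W \<subseteq> pverts H" "G = add_leaf H x W"
proof -
  obtain x where "minimal_in G (pverts G) x"
    using ex_minimal_below assms by blast
  then have x: "x \<in> pverts G" and leaf: "\<And>y. y \<preceq>\<^bsub>G\<^esub> x \<Longrightarrow> y = x"
    unfolding minimal_in_def using below_in_verts by blast+
  have no_loop: "(v, v) \<notin> parcs G" for v
    using acyclic_arcs by (auto simp: acyclic_def)
  \<comment> \<open>The head of such an arc would be below \<open>x\<close>, hence equal to
    \<open>x\<close>, giving a loop.\<close>
  have out: "(x, y) \<notin> parcs G" for y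
    using leaf[of y] no_loop[of x] by auto
  define H where "H = \<lparr>pverts = pverts G - {x}, parcs = {(u, v) \<in> parcs G. v \<noteq> x}\<rparr>"
  define W where "W = {w. (w, x) \<in> parcs G}"
  have "parcs H \<subseteq> parcs G"
    by (auto simp: H_def)
  then have "acyclic (parcs H)"
    using acyclic_arcs acyclic_subset by blast
  moreover have "pair_wf_digraph H"
    using out by unfold_locales (auto simp: H_def dest: in_arcsD1 in_arcsD2)
  ultimately have "finite_acyclic H"
    using finite_verts by (simp add: finite_acyclic_def finite_acyclic_axioms_def H_def)
  moreover have "x \<notin> pverts H"
    by (simp add: H_def)
  moreover have "W \<subseteq> pverts H"
    using no_loop by (auto simp: H_def W_def dest: in_arcsD1)
  moreover have "G = add_leaf H x W"
    using x by (intro pair_pre_digraph.equality) (auto simp: add_leaf_def H_def W_def)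
  ultimately show ?thesis
    by (rule that)
qed

end

section \<open>The two directions of the equivalence\<close>

text \<open>Acyclicity is carried through the induction because the facts on attaching a leaf
  presuppose it for the smaller graph.\<close>

lemma holju_imp_has_joins: "holju G \<Longrightarrow> finite_acyclic G \<and> has_joins G"
proof (induction rule: holju.induct)
  case (single x)
  have "finite_acyclic \<lparr>pverts = {x}, parcs = {}\<rparr>"
    by unfold_locales (auto simp: acyclic_def)
  then interpret finite_acyclic "\<lparr>pverts = {x}, parcs = {}\<rparr>" .
  show ?case
    using finite_acyclic_axioms by (auto simp: has_joins_def is_lub_def)
next
  case (extend G x W)
  then interpret finite_acyclic G
    by simp
  show ?case
    using extend finite_acyclic_add_leaf[of x W] has_joins_add_leaf_iff[of x W]
    by (simp add: add_leaf_def)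
qed

text \<open>Induction on the number of vertices: \<open>has_joins_add_leaf_iff\<close>, read from
  left to right, passes joins to the graph without the leaf and yields the condition of
  \<open>holju.extend\<close>.\<close>

lemma has_joins_imp_holju:
  assumes "finite_acyclic G" "pverts G \<noteq> {}" "has_joins G"
  shows "holju G"
  using assms
proof (induction "card (pverts G)" arbitrary: G)
  case 0
  then show ?case
    by (simp add: finite_acyclic.finite_verts)
next
  case (Suc n)
  interpret finite_acyclic G
    by (rule Suc.prems(1))
  obtain H x W where H: "finite_acyclic H" and x: "x \<notin> pverts H" and W: "W \<subseteq> pverts H"
    and G: "G = add_leaf H x W"
    using remove_leaf[OF Suc.prems(2)] .
  interpret H: finite_acyclic H
    by (rule H)
  show ?case
  proof (cases "pverts H = {}")
    case True
    \<comment> \<open>With \<open>H\<close> empty, \<open>W\<close> is empty too and only the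
      isolated vertex \<open>x\<close> remains.\<close>
    then have "G = \<lparr>pverts = {x}, parcs = {}\<rparr>"
      using W H.in_arcsD1 by (auto simp: G add_leaf_def)
    then show ?thesis
      using holju.single by simp
  next
    case False
    have joins: "has_joins H" "\<forall>v\<in>pverts H. \<exists>!u. minimal_in H (LCA_union H W v) u"
      using Suc.prems(3) H.has_joins_add_leaf_iff[OF x W] by (simp_all add: G)
    \<comment> \<open>For empty \<open>W\<close> the set \<open>LCA_union H W v\<close> would be
      empty and have no minimal element, although \<open>H\<close> has a vertex
      \<open>v\<close>.\<close>
    then have "W \<noteq> {}"
      using False by (auto simp: LCA_union_def minimal_in_def)
    moreover have "n = card (pverts H)"
      using Suc.hyps(2) x H.finite_verts by (simp add: G add_leaf_def)
    then have "holju H"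
      using H False joins(1) by (rule Suc.hyps(1))
    ultimately show ?thesis
      unfolding G add_leaf_def using x W joins(2) by (intro holju.extend) simp_all
  qed
qed

theorem theorem5p5:
  fixes G :: "'a pair_pre_digraph"
  assumes "network G"
  shows "global_lca_property G \<longleftrightarrow> holju G"
proof -
  interpret network G
    by (rule assms)
  interpret finite_acyclic G
    by (rule finite_acyclic)
  \<comment> \<open>The maximal vertex of the network witnesses this.\<close>
  have "pverts G \<noteq> {}"
    using unique_maximal[THEN ex1_implies_ex] by (auto simp: maximal_in_def)
  then show ?thesis
    unfolding global_lca_property_iff_has_joins
    using has_joins_imp_holju[OF finite_acyclic] holju_imp_has_joins by blast
qed

end
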